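(* Let $\{X_n,\mathcal{F}_n\}_{n\ge0}$ be a discrete-time, real-valued supermartingale and let $\eta_k=X_k-\mathbb{E}[X_k\mid\mathcal{F}_{k-1}]$ for $k\ge1$. Assume that there exists a fixed number $d>0$ such that $\eta_k\le d$ almost surely for every integer $k\ge1$. Let $Q_n=\sum_{k=1}^n\mathbb{E}[\eta_k^2\mid\mathcal{F}_{k-1}]$ for every $n\ge1$, and $Q_0=0$. Then for every $z,r>0$, $$\mathbb{P}\Big(\text{there exists an integer } n\ge1 \text{ such that } \max_{1\le k\le n}(X_k-X_0)\ge z \text{ and } Q_n\le r\Big)\le\exp\left(-\frac{z^2}{2r}\,B\Big(\frac{zd}{r}\Big)\right),$$ where $$B(u)=\frac{2\big[(1+u)\ln(1+u)-u\big]}{u^2},\qquad u>0.$$ Furthermore, if the supermartingale is conditionally symmetric, then for every $z,r>0$, $$\mathbb{P}\Big(\text{there exists an integer } n\ge1 \text{ such that } \max_{1\le k\le n}(X_k-X_0)\ge z \text{ and } Q_n\le r\Big)\le\exp\left(-\frac{z^2}{2r}\,C\Big(\frac{zd}{r}\Big)\right),$$ where $$C(u)=\frac{2\big[u\sinh^{-1}(u)-\sqrt{1+u^2}+1\big]}{u^2},\qquad u>0.$$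
   Context: A discrete-time real-valued supermartingale $\{X_k,\mathcal{F}_k\}_{k\ge0}$ is called conditionally symmetric if for every $k\ge1$, conditioned on $\mathcal{F}_{k-1}$, the random variable $\eta_k=X_k-\mathbb{E}[X_k\mid\mathcal{F}_{k-1}]$ is symmetrically distributed around zero (i.e. $\eta_k$ and $-\eta_k$ have the same conditional law given $\mathcal{F}_{k-1}$). The conditional expectation of the non-negative random variable $\eta_k^2$ is understood as a $[0,\infty]$-valued random variable. Here $\sinh^{-1}$ denotes the inverse hyperbolic sine function. *)

theory Defs
  imports "HOL-Probability.Probability"
begin

locale supermartingale = prob_space M + filtration "space M" F
  for M :: "'a measure" and F :: "nat \<Rightarrow> 'a measure" +
  fixes X :: "nat \<Rightarrow> 'a \<Rightarrow> real"
  assumes subalgebra_F: "\<And>n. subalgebra M (F n)"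
    and adapted: "\<And>n. X n \<in> borel_measurable (F n)"
    and integrable_X: "\<And>n. integrable M (X n)"
    and cond_exp_le: "\<And>n. AE x in M. real_cond_exp M (F n) (X (Suc n)) x \<le> X n x"

(* Only indices k >= 1 are meaningful: at k = 0 the subtraction k - 1 truncates. *)
definition innovation ::
    "'a measure \<Rightarrow> (nat \<Rightarrow> 'a measure) \<Rightarrow> (nat \<Rightarrow> 'a \<Rightarrow> real) \<Rightarrow> nat \<Rightarrow> 'a \<Rightarrow> real" where
  "innovation M F X k = (\<lambda>x. X k x - real_cond_exp M (F (k - 1)) (X k) x)"

(* Second moments are not assumed finite, so this takes values in [0, \<infinity>]. *)
definition quad_var ::
    "'a measure \<Rightarrow> (nat \<Rightarrow> 'a measure) \<Rightarrow> (nat \<Rightarrow> 'a \<Rightarrow> real) \<Rightarrow> nat \<Rightarrow> 'a \<Rightarrow> ennreal" where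
  "quad_var M F X n =
     (\<lambda>x. \<Sum>k=1..n. nn_cond_exp M (F (k - 1)) (\<lambda>y. ennreal ((innovation M F X k y)\<^sup>2)) x)"

(* Y and -Y have the same conditional law given G: P(Y : A | G) = P(-Y : A | G) almost surely,
   for every Borel set A. The exceptional null set may depend on A; as the Borel sets of the
   reals are countably generated, this is the same as equality of regular conditional laws. *)
definition cond_symmetric_rv :: "'a measure \<Rightarrow> 'a measure \<Rightarrow> ('a \<Rightarrow> real) \<Rightarrow> bool" where
  "cond_symmetric_rv M G Y \<longleftrightarrow>
     (\<forall>A\<in>sets borel. AE x in M.
        real_cond_exp M G (\<lambda>y. indicator A (Y y)) x = real_cond_exp M G (\<lambda>y. indicator A (- Y y)) x)"

definition conditionally_symmetric ::
    "'a measure \<Rightarrow> (nat \<Rightarrow> 'a measure) \<Rightarrow> (nat \<Rightarrow> 'a \<Rightarrow> real) \<Rightarrow> bool" where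
  "conditionally_symmetric M F X \<longleftrightarrow>
     supermartingale M F X \<and> (\<forall>k\<ge>1. cond_symmetric_rv M (F (k - 1)) (innovation M F X k))"

(* Both functions are used only for u > 0. *)
definition B_fun :: "real \<Rightarrow> real" where
  "B_fun u = 2 * ((1 + u) * ln (1 + u) - u) / u\<^sup>2"

definition C_fun :: "real \<Rightarrow> real" where
  "C_fun u = 2 * (u * arsinh u - sqrt (1 + u\<^sup>2) + 1) / u\<^sup>2"

end

theory Submission
  imports Defs
begin

text \<open>
  The proof is Freedman's exponential supermartingale argument. Up to a nonincreasing compensator,
  \<open>X n - X 0\<close> is the sum of the innovations \<open>\<eta> k\<close>. Suppose that for some \<open>l > 0\<close> and \<open>p \<ge> 0\<close>
  the conditional expectation of \<open>exp (l * \<eta> k)\<close> given the past is at most \<open>1 + p * V k\<close>, where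
  \<open>V k\<close> is the conditional second moment of \<open>\<eta> k\<close>. Since \<open>1 + p * v \<le> exp (p * v)\<close>, the process
  \<open>exp (l * (\<eta> 1 + \<dots> + \<eta> n) - p * Q n)\<close> is a nonnegative supermartingale started at \<open>1\<close>. On the
  event in question it reaches \<open>exp (l * z - p * r)\<close> at some time, so by the maximal inequality
  (\<open>supermartingale_maximal_inequality\<close>) the event has probability at most \<open>exp (p * r - l * z)\<close>;
  this is \<open>exponential_supermartingale_tail\<close>.

  The two claims differ only in the constant \<open>p\<close>. If \<open>\<eta> k \<le> d\<close>, then the monotonicity of
  \<open>(exp x - 1 - x) / x\<^sup>2\<close> and the vanishing conditional mean of \<open>\<eta> k\<close> give
  \<open>p = (exp (l * d) - 1 - l * d) / d\<^sup>2\<close> (\<open>nn_cond_exp_exp_bounded_above\<close>). If in addition \<open>\<eta> k\<close> is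
  conditionally symmetric, then \<open>exp\<close> can be replaced by \<open>cosh\<close>, which gives
  \<open>p = (cosh (l * d) - 1) / d\<^sup>2\<close> (\<open>nn_cond_exp_exp_symmetric\<close>). Minimising \<open>p * r - l * z\<close> over \<open>l\<close>
  produces the functions \<open>B_fun\<close> and \<open>C_fun\<close>, with \<open>l * d = ln (1 + z * d / r)\<close> and
  \<open>l * d = arsinh (z * d / r)\<close> respectively.

  Conditional second moments may be infinite, so conditional expectations of nonnegative variables
  are taken in \<open>[0, \<infinity>]\<close> throughout.
\<close>

section \<open>Quadratic bounds for the exponential function and the hyperbolic cosine\<close>

text \<open>
  A power series that starts at degree two with nonnegative coefficients, divided by \<open>x\<^sup>2\<close>, is
  again such a series and hence increasing in \<open>x \<ge> 0\<close>; the statement clears the denominators so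
  that \<open>x = 0\<close> is covered.
\<close>
lemma power_series_quadratic_comparison:
  fixes a :: "nat \<Rightarrow> real"
  assumes "\<And>n. 0 \<le> a n" and "0 \<le> x" "x \<le> c"
    and s: "(\<lambda>n. a n * x ^ (n + 2)) sums s" and t: "(\<lambda>n. a n * c ^ (n + 2)) sums t"
  shows "s * c\<^sup>2 \<le> t * x\<^sup>2"
proof (rule sums_le[OF _ sums_mult2[OF s] sums_mult2[OF t]])
  fix n
  have "a n * x ^ n * (x\<^sup>2 * c\<^sup>2) \<le> a n * c ^ n * (x\<^sup>2 * c\<^sup>2)"
    using assms by (intro mult_right_mono mult_left_mono power_mono) auto
  then show "a n * x ^ (n + 2) * c\<^sup>2 \<le> a n * c ^ (n + 2) * x\<^sup>2"
    by (simp add: power_add power2_eq_square mult_ac)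
qed

lemma exp_minus_affine_sums:
  "(\<lambda>n. inverse (fact (n + 2)) * x ^ (n + 2)) sums (exp x - 1 - x :: real)"
  using sums_split_initial_segment[OF exp_converges[of x], of 2]
  by (simp add: numeral_2_eq_2 algebra_simps)

lemma cosh_minus_one_sums:
  "(\<lambda>n. (if even n then inverse (fact (n + 2)) else 0) * x ^ (n + 2)) sums (cosh x - 1 :: real)"
proof -
  have "(\<lambda>n. if even (n + 2) then x ^ (n + 2) /\<^sub>R fact (n + 2) else 0) sums (cosh x - 1)"
    using sums_split_initial_segment[OF cosh_converges[of x], of 2] by (simp add: numeral_2_eq_2)
  then show ?thesis
    by (rule back_subst[where P = "\<lambda>f. f sums (cosh x - 1)"]) (auto simp: fun_eq_iff)
qed

lemma exp_nonpos_le_quadratic: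
  fixes x :: real
  assumes "x \<le> 0"
  shows "exp x \<le> 1 + x + x\<^sup>2 / 2"
proof -
  have "1 + (-x) + (-x)\<^sup>2 / 2 \<le> exp (-x)"
    using assms by (intro exp_lower_Taylor_quadratic) auto
  moreover have pos: "0 < 1 + x + x\<^sup>2 / 2"
  proof -
    have "1 + x + x\<^sup>2 / 2 = ((1 + x)\<^sup>2 + 1) / 2"
      by (simp add: power2_eq_square field_simps)
    also have "0 < \<dots>" by (simp add: add_nonneg_pos)
    finally show ?thesis .
  qed
  ultimately have "(1 + x + x\<^sup>2 / 2) * (1 - x + x\<^sup>2 / 2) \<le> (1 + x + x\<^sup>2 / 2) * exp (-x)"
    by (intro mult_left_mono) auto
  moreover have "(1 + x + x\<^sup>2 / 2) * (1 - x + x\<^sup>2 / 2) = 1 + (x\<^sup>2 / 2)\<^sup>2"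
    by (simp add: power2_eq_square field_simps)
  moreover have "0 \<le> (x\<^sup>2 / 2)\<^sup>2" by simp
  ultimately have "1 \<le> (1 + x + x\<^sup>2 / 2) * exp (-x)"
    by linarith
  then show ?thesis
    by (simp add: exp_minus field_simps)
qed

text \<open>
  The quotient \<open>(exp x - 1 - x) / x\<^sup>2\<close> increases on the whole line, so on \<open>(-\<infinity>, c]\<close> it is at
  most its value at \<open>c\<close>. Its value at \<open>0\<close>, which is \<open>1/2\<close>, separates the two cases: for positive
  \<open>x\<close> the power series decides, for negative \<open>x\<close> both sides are compared with \<open>1/2\<close>.
\<close>
lemma exp_le_quadratic:
  fixes x c :: real
  assumes "x \<le> c" "0 < c"
  shows "exp x \<le> 1 + x + (exp c - 1 - c) / c\<^sup>2 * x\<^sup>2"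
proof (cases "0 \<le> x")
  case True
  have "(exp x - 1 - x) * c\<^sup>2 \<le> (exp c - 1 - c) * x\<^sup>2"
    using True assms
    by (intro power_series_quadratic_comparison[OF _ _ _ exp_minus_affine_sums exp_minus_affine_sums]) auto
  then show ?thesis
    using assms by (simp add: field_simps)
next
  case False
  have "1 / 2 \<le> (exp c - 1 - c) / c\<^sup>2"
    using exp_lower_Taylor_quadratic[of c] assms by (simp add: field_simps)
  from mult_right_mono[OF this zero_le_power2[of x]] show ?thesis
    using exp_nonpos_le_quadratic[of x] False by linarith
qed

lemma cosh_le_quadratic:
  fixes x c :: real
  assumes "\<bar>x\<bar> \<le> c" "0 < c"
  shows "cosh x \<le> 1 + (cosh c - 1) / c\<^sup>2 * x\<^sup>2"
proof -
  have "(cosh \<bar>x\<bar> - 1) * c\<^sup>2 \<le> (cosh c - 1) * \<bar>x\<bar>\<^sup>2"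
    using assms
    by (intro power_series_quadratic_comparison[OF _ _ _ cosh_minus_one_sums cosh_minus_one_sums]) auto
  then show ?thesis
    using assms by (simp add: field_simps)
qed

section \<open>Maximal inequality for nonnegative supermartingales\<close>

lemma sigma_finite_subalgebra_of_prob_space:
  assumes "prob_space M" "subalgebra M G"
  shows "sigma_finite_subalgebra M G"
  using assms prob_space.finite_measure
  by (intro finite_measure_subalgebra_is_sigma_finite finite_measure_subalgebra.intro
        finite_measure_subalgebra_axioms.intro)

text \<open>
  Ville's inequality for nonnegative supermartingales, with the supermartingale property stated by
  integrals over sets of the past, so that it makes sense for values in \<open>[0, \<infinity>]\<close>. Let \<open>H n\<close> be
  the event that the level \<open>c\<close> has been reached by time \<open>n\<close>. The quantity
  \<open>c * P (H n) + E (W n; not H n)\<close> does not increase with \<open>n\<close>: off \<open>H n\<close> the supermartingale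
  property allows one to pass from \<open>W n\<close> to \<open>W (Suc n)\<close>, and on the part where the level is reached
  at time \<open>Suc n\<close> the value of \<open>W (Suc n)\<close> is at least \<open>c\<close>.
\<close>
lemma supermartingale_maximal_inequality:
  fixes W :: "nat \<Rightarrow> 'a \<Rightarrow> ennreal"
  assumes sub: "\<And>n. subalgebra M (F n)"
    and F_mono: "\<And>n. sets (F n) \<subseteq> sets (F (Suc n))"
    and meas: "\<And>n. W n \<in> borel_measurable (F n)"
    and super: "\<And>n A. A \<in> sets (F n) \<Longrightarrow> (\<integral>\<^sup>+x\<in>A. W (Suc n) x \<partial>M) \<le> (\<integral>\<^sup>+x\<in>A. W n x \<partial>M)"
  shows "c * emeasure M {x \<in> space M. \<exists>n. c \<le> W n x} \<le> (\<integral>\<^sup>+x. W 0 x \<partial>M)"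
proof -
  define H where "H n = {x \<in> space M. \<exists>k\<le>n. c \<le> W k x}" for n
  have space_F: "space (F n) = space M" for n
    using sub[of n] by (simp add: subalgebra_def)
  have FM: "A \<in> sets (F n) \<Longrightarrow> A \<in> sets M" for A n
    using sub[of n] by (auto simp: subalgebra_def)
  have [measurable]: "W n \<in> borel_measurable M" for n
    using measurable_from_subalg[OF sub meas] .
  have new: "{x \<in> space M. c \<le> W n x} \<in> sets (F n)" for n
  proof -
    have "{x \<in> space (F n). c \<le> W n x} \<in> sets (F n)"
      using meas[of n] by measurable
    then show ?thesis by (simp add: space_F)
  qed
  have H_Suc: "H (Suc n) = H n \<union> {x \<in> space M. c \<le> W (Suc n) x}" for n
    by (auto simp: H_def le_Suc_eq)
  have H_F: "H n \<in> sets (F n)" for n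
  proof (induction n)
    case 0
    then show ?case using new[of 0] by (simp add: H_def)
  next
    case (Suc n)
    then show ?case unfolding H_Suc using new F_mono by blast
  qed
  note [measurable] = FM[OF H_F]
  have step: "c * emeasure M (H n) + (\<integral>\<^sup>+x\<in>space M - H n. W n x \<partial>M) \<le> (\<integral>\<^sup>+x. W 0 x \<partial>M)" for n
  proof (induction n)
    case 0
    have "c * emeasure M (H 0) + (\<integral>\<^sup>+x\<in>space M - H 0. W 0 x \<partial>M)
        = (\<integral>\<^sup>+x. c * indicator (H 0) x + W 0 x * indicator (space M - H 0) x \<partial>M)"
      by (subst nn_integral_add) (auto simp: nn_integral_cmult_indicator)
    also have "\<dots> \<le> (\<integral>\<^sup>+x. W 0 x \<partial>M)"
      by (intro nn_integral_mono) (auto simp: H_def indicator_def)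
    finally show ?case .
  next
    case (Suc n)
    \<comment> \<open>the event that the level is reached for the first time at time \<open>Suc n\<close>\<close>
    define D where "D = H (Suc n) - H n"
    have [measurable]: "D \<in> sets M" by (simp add: D_def)
    have "emeasure M (H (Suc n)) = emeasure M (H n) + emeasure M D"
      by (subst plus_emeasure) (auto simp: D_def H_Suc intro!: arg_cong[where f = "emeasure M"])
    then have "c * emeasure M (H (Suc n)) + (\<integral>\<^sup>+x\<in>space M - H (Suc n). W (Suc n) x \<partial>M)
        = c * emeasure M (H n)
          + (\<integral>\<^sup>+x. c * indicator D x + W (Suc n) x * indicator (space M - H (Suc n)) x \<partial>M)"
      by (subst nn_integral_add) (auto simp: nn_integral_cmult_indicator distrib_left add.assoc)
    also have "\<dots> \<le> c * emeasure M (H n) + (\<integral>\<^sup>+x\<in>space M - H n. W (Suc n) x \<partial>M)"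
      by (intro add_left_mono nn_integral_mono) (auto simp: D_def H_Suc indicator_def)
    also have "\<dots> \<le> c * emeasure M (H n) + (\<integral>\<^sup>+x\<in>space M - H n. W n x \<partial>M)"
      using sets.compl_sets[OF H_F[of n]] by (intro add_left_mono super) (simp add: space_F)
    also note Suc.IH
    finally show ?case .
  qed
  have "c * emeasure M {x \<in> space M. \<exists>n. c \<le> W n x} = c * emeasure M (\<Union>n. H n)"
    by (intro arg_cong2[where f = "(*)"] arg_cong[where f = "emeasure M"]) (auto simp: H_def)
  also have "\<dots> = (SUP n. c * emeasure M (H n))"
    by (subst SUP_emeasure_incseq[symmetric])
       (auto simp: SUP_mult_left_ennreal incseq_Suc_iff H_Suc)
  also have "\<dots> \<le> (\<integral>\<^sup>+x. W 0 x \<partial>M)"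
  proof (rule SUP_least)
    show "c * emeasure M (H n) \<le> (\<integral>\<^sup>+x. W 0 x \<partial>M)" for n
      using add_increasing2[OF zero_le order_refl] step[of n] by (rule order_trans)
  qed
  finally show ?thesis .
qed

section \<open>The exponential supermartingale\<close>

text \<open>
  This is \<open>exp (- p * v)\<close> with the value \<open>0\<close> at \<open>v = \<infinity>\<close>, also for \<open>p = 0\<close>. Where a conditional
  variance is infinite, the exponential process below is thus killed and stays a supermartingale;
  such paths do not satisfy a finite bound on the quadratic variation anyway.
\<close>
definition exp_discount :: "real \<Rightarrow> ennreal \<Rightarrow> ennreal" where
  "exp_discount p v = (if v = \<infinity> then 0 else ennreal (exp (- p * enn2real v)))"

lemma borel_measurable_exp_discount [measurable]: "exp_discount p \<in> borel_measurable borel"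
  unfolding exp_discount_def by measurable

lemma exp_discount_compensates:
  assumes "0 \<le> p"
  shows "exp_discount p v * (1 + ennreal p * v) \<le> 1"
proof (cases v)
  case (real s)
  have "exp (- p * s) * (1 + p * s) \<le> exp (- p * s) * exp (p * s)"
    using exp_ge_add_one_self by (intro mult_left_mono) auto
  also have "\<dots> = 1" by (simp flip: exp_add)
  finally show ?thesis
    using real assms
    by (simp add: exp_discount_def flip: ennreal_mult ennreal_1 ennreal_plus)
qed (simp add: exp_discount_def)

lemma prod_exp_discount:
  assumes "finite A" "(\<Sum>k\<in>A. v k) < \<infinity>"
  shows "(\<Prod>k\<in>A. ennreal (exp (f k)) * exp_discount p (v k))
    = ennreal (exp ((\<Sum>k\<in>A. f k) - p * enn2real (\<Sum>k\<in>A. v k)))"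
  using assms
proof (induction A rule: finite_induct)
  case (insert a A)
  then have fin: "v a < \<infinity>" "(\<Sum>k\<in>A. v k) < \<infinity>" by auto
  with insert have "(\<Prod>k\<in>insert a A. ennreal (exp (f k)) * exp_discount p (v k))
    = ennreal (exp (f a)) * ennreal (exp (- p * enn2real (v a)))
      * ennreal (exp ((\<Sum>k\<in>A. f k) - p * enn2real (\<Sum>k\<in>A. v k)))"
    by (auto simp: exp_discount_def)
  also have "\<dots> = ennreal (exp ((\<Sum>k\<in>insert a A. f k) - p * enn2real (\<Sum>k\<in>insert a A. v k)))"
    using insert.hyps fin
    by (simp add: enn2real_plus algebra_simps flip: ennreal_mult exp_add)
  finally show ?case .
qed simp

text \<open>
  The hypothesis on the conditional moment generating function makes
  \<open>W n = exp (l * S n - p * Q n)\<close> a nonnegative supermartingale started at \<open>1\<close>, where \<open>S n\<close> and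
  \<open>Q n\<close> are the partial sums of \<open>\<xi>\<close> and \<open>V\<close>. If \<open>S n \<ge> z\<close> and \<open>Q n \<le> r\<close> at some time, then
  \<open>W n \<ge> exp (l * z - p * r)\<close> at that time, and the maximal inequality applies. The sequences are
  indexed from \<open>0\<close>: the increment \<open>\<xi> k\<close> is revealed at time \<open>Suc k\<close>, and \<open>V k\<close> is known at time \<open>k\<close>.
\<close>
lemma exponential_supermartingale_tail:
  fixes \<xi> :: "nat \<Rightarrow> 'a \<Rightarrow> real" and V :: "nat \<Rightarrow> 'a \<Rightarrow> ennreal"
  assumes "prob_space M" "filtration (space M) F" and sub: "\<And>n. subalgebra M (F n)"
    and \<xi>: "\<And>k. \<xi> k \<in> borel_measurable (F (Suc k))"
    and V: "\<And>k. V k \<in> borel_measurable (F k)"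
    and mgf: "\<And>k. AE x in M. nn_cond_exp M (F k) (\<lambda>y. ennreal (exp (l * \<xi> k y))) x
                            \<le> 1 + ennreal p * V k x"
    and "0 \<le> l" "0 \<le> p" "0 \<le> r"
  shows "{x \<in> space M. \<exists>n. z \<le> (\<Sum>k<n. \<xi> k x) \<and> (\<Sum>k<n. V k x) \<le> ennreal r} \<in> sets M" (is "?E \<in> _")
    and "measure M {x \<in> space M. \<exists>n. z \<le> (\<Sum>k<n. \<xi> k x) \<and> (\<Sum>k<n. V k x) \<le> ennreal r}
           \<le> exp (p * r - l * z)"
proof -
  interpret prob_space M by fact
  interpret filtration "space M" F by fact
  have [measurable]: "\<xi> k \<in> borel_measurable M" "V k \<in> borel_measurable M" for k
    using measurable_from_subalg[OF sub] \<xi> V by blast+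
  show E [measurable]: "?E \<in> sets M" by measurable
  define W where "W n x = (\<Prod>k<n. ennreal (exp (l * \<xi> k x)) * exp_discount p (V k x))" for n x
  have up: "f \<in> borel_measurable (F m)" if "f \<in> borel_measurable (F k)" "k \<le> m"
    for f :: "'a \<Rightarrow> 'b :: topological_space" and k m
    using that sets_F_mono[of k m] by (auto simp: measurable_def space_F)
  have W_F [measurable]: "W n \<in> borel_measurable (F n)" for n
  proof -
    have [measurable]: "\<xi> k \<in> borel_measurable (F n)" "V k \<in> borel_measurable (F n)" if "k < n" for k
      using that up[OF \<xi>, of k n] up[OF V, of k n] by auto
    show ?thesis
      unfolding W_def
      by (intro borel_measurable_prod_ennreal borel_measurable_times_ennreal) measurable
  qed
  have "ennreal (exp (l * z - p * r)) * emeasure M {x \<in> space M. \<exists>n. ennreal (exp (l * z - p * r)) \<le> W n x}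
      \<le> (\<integral>\<^sup>+x. W 0 x \<partial>M)"
  proof (rule supermartingale_maximal_inequality[OF sub _ W_F])
    show "sets (F n) \<subseteq> sets (F (Suc n))" for n by (rule sets_F_mono) simp
  next
    fix n A assume A: "A \<in> sets (F n)"
    interpret sigma_finite_subalgebra M "F n"
      using \<open>prob_space M\<close> sub by (rule sigma_finite_subalgebra_of_prob_space)
    define g where "g x = W n x * exp_discount p (V n x) * indicator A x" for x
    have g [measurable]: "g \<in> borel_measurable (F n)"
      unfolding g_def using A V[of n] by measurable
    have "(\<integral>\<^sup>+x\<in>A. W (Suc n) x \<partial>M) = (\<integral>\<^sup>+x. g x * ennreal (exp (l * \<xi> n x)) \<partial>M)"
      by (simp add: W_def g_def mult_ac)
    also have "\<dots> = (\<integral>\<^sup>+x. g x * nn_cond_exp M (F n) (\<lambda>y. ennreal (exp (l * \<xi> n y))) x \<partial>M)"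
      by (intro nn_cond_exp_intg[symmetric]) auto
    also have "\<dots> \<le> (\<integral>\<^sup>+x\<in>A. W n x \<partial>M)"
    proof (rule nn_integral_mono_AE)
      show "AE x in M. g x * nn_cond_exp M (F n) (\<lambda>y. ennreal (exp (l * \<xi> n y))) x
              \<le> W n x * indicator A x"
        using mgf[of n]
      proof eventually_elim
        case (elim x)
        have "g x * nn_cond_exp M (F n) (\<lambda>y. ennreal (exp (l * \<xi> n y))) x
            \<le> (W n x * indicator A x) * (exp_discount p (V n x) * (1 + ennreal p * V n x))"
          using mult_left_mono[OF elim, of "g x"] by (simp add: g_def mult_ac)
        also have "\<dots> \<le> (W n x * indicator A x) * 1"
          using \<open>0 \<le> p\<close> by (intro mult_left_mono exp_discount_compensates) auto
        finally show ?case by simp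
      qed
    qed
    finally show "(\<integral>\<^sup>+x\<in>A. W (Suc n) x \<partial>M) \<le> (\<integral>\<^sup>+x\<in>A. W n x \<partial>M)" .
  qed
  also have "\<dots> = 1" by (simp add: W_def emeasure_space_1)
  finally have ville: "ennreal (exp (l * z - p * r))
      * emeasure M {x \<in> space M. \<exists>n. ennreal (exp (l * z - p * r)) \<le> W n x} \<le> 1" .
  have WM [measurable]: "W n \<in> borel_measurable M" for n
    using measurable_from_subalg[OF sub W_F] .
  have "?E \<subseteq> {x \<in> space M. \<exists>n. ennreal (exp (l * z - p * r)) \<le> W n x}"
  proof safe
    fix x n assume z: "z \<le> (\<Sum>k<n. \<xi> k x)" and r: "(\<Sum>k<n. V k x) \<le> ennreal r"
    have "enn2real (\<Sum>k<n. V k x) \<le> r"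
      using r \<open>0 \<le> r\<close> by (simp add: enn2real_leI)
    then have "l * z - p * r \<le> (\<Sum>k<n. l * \<xi> k x) - p * enn2real (\<Sum>k<n. V k x)"
      using z \<open>0 \<le> l\<close> \<open>0 \<le> p\<close> by (auto simp flip: sum_distrib_left intro!: diff_mono mult_left_mono)
    moreover have "(\<Sum>k<n. V k x) < \<infinity>"
      using r by (simp add: le_less_trans)
    ultimately have "ennreal (exp (l * z - p * r)) \<le> W n x"
      unfolding W_def by (subst prod_exp_discount) (auto intro: ennreal_leI)
    then show "\<exists>n. ennreal (exp (l * z - p * r)) \<le> W n x" ..
  qed
  then have "emeasure M ?E \<le> emeasure M {x \<in> space M. \<exists>n. ennreal (exp (l * z - p * r)) \<le> W n x}"
    by (intro emeasure_mono) auto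
  from order_trans[OF mult_left_mono[OF this] ville]
  have "exp (l * z - p * r) * measure M ?E \<le> 1"
    by (simp add: emeasure_eq_measure flip: ennreal_mult ennreal_1)
  then show "measure M ?E \<le> exp (p * r - l * z)"
    by (simp add: exp_diff field_simps)
qed

section \<open>Conditional exponential moments of variables bounded above\<close>

context sigma_finite_subalgebra
begin

lemma nn_cond_exp_affine:
  assumes [measurable]: "f \<in> borel_measurable M"
  shows "AE x in M. nn_cond_exp M F (\<lambda>x. a + b * f x) x = a + b * nn_cond_exp M F f x"
proof -
  have "AE x in M. a = nn_cond_exp M F (\<lambda>_. a) x"
    by (rule nn_cond_exp_F_meas) simp
  moreover have "AE x in M. b * nn_cond_exp M F f x = nn_cond_exp M F (\<lambda>x. b * f x) x"
    by (rule nn_cond_exp_prod) auto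
  moreover have "AE x in M. nn_cond_exp M F (\<lambda>_. a) x + nn_cond_exp M F (\<lambda>x. b * f x) x
      = nn_cond_exp M F (\<lambda>x. a + b * f x) x"
    by (rule nn_cond_exp_sum) auto
  ultimately show ?thesis by eventually_elim simp
qed

lemma nn_cond_exp_finite:
  assumes [measurable]: "f \<in> borel_measurable M" and "(\<integral>\<^sup>+x. f x \<partial>M) \<noteq> \<infinity>"
  shows "AE x in M. nn_cond_exp M F f x \<noteq> \<infinity>"
proof (rule nn_integral_PInf_AE)
  show "(\<integral>\<^sup>+x. nn_cond_exp M F f x \<partial>M) \<noteq> \<infinity>"
    using nn_cond_exp_intg[of "\<lambda>_. 1" f] assms by simp
qed simp

text \<open>
  Taking conditional expectations in \<open>exp (l * Y) \<le> 1 + l * Y + p * Y\<^sup>2\<close> removes the linear term.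
  Because the conditional second moment may be infinite, the argument runs in \<open>[0, \<infinity>]\<close>: the
  negative part of \<open>l * Y\<close> is moved to the left, and the conditional expectations of the two parts,
  which are finite and equal almost surely, cancel at the end.
\<close>
lemma nn_cond_exp_exp_bounded_above:
  fixes Y :: "'a \<Rightarrow> real"
  assumes int: "integrable M Y" and mean: "AE x in M. real_cond_exp M F Y x = 0"
    and bd: "AE x in M. Y x \<le> d" and "0 < d" "0 < l"
  shows "AE x in M. nn_cond_exp M F (\<lambda>y. ennreal (exp (l * Y y))) x
    \<le> 1 + ennreal ((exp (l * d) - 1 - l * d) / d\<^sup>2) * nn_cond_exp M F (\<lambda>y. ennreal ((Y y)\<^sup>2)) x"
proof -
  define p where "p = (exp (l * d) - 1 - l * d) / d\<^sup>2"
  have "0 \<le> p"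
    using exp_ge_add_one_self[of "l * d"] unfolding p_def
    by (intro divide_nonneg_nonneg zero_le_power2) linarith
  let ?E = "nn_cond_exp M F"
  have [measurable]: "Y \<in> borel_measurable M" using int by auto
  have fin: "(\<integral>\<^sup>+x. ennreal (Y x) \<partial>M) \<noteq> \<infinity>" "(\<integral>\<^sup>+x. ennreal (- Y x) \<partial>M) \<noteq> \<infinity>"
    using int by (auto simp: real_integrable_def)
  have "AE x in M. ?E (\<lambda>y. ennreal (exp (l * Y y)) + ennreal l * ennreal (- Y y)) x
      \<le> ?E (\<lambda>y. (1 + ennreal l * ennreal (Y y)) + ennreal p * ennreal ((Y y)\<^sup>2)) x"
  proof (rule nn_cond_exp_mono)
    show "AE x in M. ennreal (exp (l * Y x)) + ennreal l * ennreal (- Y x)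
        \<le> (1 + ennreal l * ennreal (Y x)) + ennreal p * ennreal ((Y x)\<^sup>2)"
      using bd
    proof eventually_elim
      case (elim x)
      have key: "exp (l * Y x) \<le> 1 + l * Y x + p * (Y x)\<^sup>2"
        using exp_le_quadratic[of "l * Y x" "l * d"] elim \<open>0 < l\<close> \<open>0 < d\<close>
        by (simp add: p_def power_mult_distrib)
      show ?case
      proof (cases "0 \<le> Y x")
        case True
        then have "ennreal (- Y x) = 0" by (simp add: ennreal_neg)
        with True key \<open>0 \<le> p\<close> \<open>0 < l\<close> show ?thesis
          by (simp flip: ennreal_mult ennreal_1 ennreal_plus)
      next
        case False
        then have "ennreal (Y x) = 0" by (simp add: ennreal_neg)
        with False key \<open>0 \<le> p\<close> \<open>0 < l\<close> show ?thesis
          by (simp add: mult_nonneg_nonpos flip: ennreal_mult ennreal_1 ennreal_plus)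
      qed
    qed
  qed auto
  moreover have "AE x in M. ?E (\<lambda>y. ennreal (exp (l * Y y))) x + ?E (\<lambda>y. ennreal l * ennreal (- Y y)) x
      = ?E (\<lambda>y. ennreal (exp (l * Y y)) + ennreal l * ennreal (- Y y)) x"
    by (rule nn_cond_exp_sum) auto
  moreover have "AE x in M. ?E (\<lambda>y. 1 + ennreal l * ennreal (Y y)) x + ?E (\<lambda>y. ennreal p * ennreal ((Y y)\<^sup>2)) x
      = ?E (\<lambda>y. (1 + ennreal l * ennreal (Y y)) + ennreal p * ennreal ((Y y)\<^sup>2)) x"
    by (rule nn_cond_exp_sum) auto
  moreover have "AE x in M. ?E (\<lambda>y. 1 + ennreal l * ennreal (Y y)) x = 1 + ennreal l * ?E (\<lambda>y. ennreal (Y y)) x"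
    by (rule nn_cond_exp_affine) auto
  moreover have "AE x in M. ?E (\<lambda>y. 0 + ennreal l * ennreal (- Y y)) x = 0 + ennreal l * ?E (\<lambda>y. ennreal (- Y y)) x"
    by (rule nn_cond_exp_affine) auto
  moreover have "AE x in M. ?E (\<lambda>y. 0 + ennreal p * ennreal ((Y y)\<^sup>2)) x = 0 + ennreal p * ?E (\<lambda>y. ennreal ((Y y)\<^sup>2)) x"
    by (rule nn_cond_exp_affine) auto
  moreover have "AE x in M. ?E (\<lambda>y. ennreal (Y y)) x \<noteq> \<infinity>" "AE x in M. ?E (\<lambda>y. ennreal (- Y y)) x \<noteq> \<infinity>"
    by (rule nn_cond_exp_finite[OF _ fin(1)] nn_cond_exp_finite[OF _ fin(2)]; simp)+
  ultimately show ?thesis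
    using mean
  proof eventually_elim
    case (elim x)
    then have "enn2real (?E (\<lambda>y. ennreal (Y y)) x) = enn2real (?E (\<lambda>y. ennreal (- Y y)) x)"
      by (simp add: real_cond_exp_def)
    with elim have eq: "?E (\<lambda>y. ennreal (Y y)) x = ?E (\<lambda>y. ennreal (- Y y)) x"
      by (metis ennreal_enn2real_if infinity_ennreal_def)
    define q where "q = ennreal l * ?E (\<lambda>y. ennreal (Y y)) x"
    have "q < \<infinity>" using elim unfolding q_def by (simp add: ennreal_mult_less_top less_top)
    have "q + ?E (\<lambda>y. ennreal (exp (l * Y y))) x \<le> q + (1 + ennreal p * ?E (\<lambda>y. ennreal ((Y y)\<^sup>2)) x)"
      using elim eq by (simp add: q_def ac_simps)
    with \<open>q < \<infinity>\<close> show ?case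
      by (auto simp: p_def ennreal_add_left_cancel_le)
  qed
qed

end

section \<open>Conditional exponential moments of conditionally symmetric variables\<close>

text \<open>
  Symmetry of the conditional law, given through indicators of Borel sets, extends to all
  nonnegative Borel functions: on each event of \<open>G\<close> the variables \<open>Y\<close> and \<open>- Y\<close> have the same
  distribution, hence the same integrals, and these integrals determine the conditional expectation.
\<close>
lemma cond_symmetric_nn_cond_exp:
  fixes Y :: "'a \<Rightarrow> real" and h :: "real \<Rightarrow> ennreal"
  assumes "prob_space M" "subalgebra M G" "cond_symmetric_rv M G Y"
    and [measurable]: "Y \<in> borel_measurable M" "h \<in> borel_measurable borel"
  shows "AE x in M. nn_cond_exp M G (\<lambda>y. h (Y y)) x = nn_cond_exp M G (\<lambda>y. h (- Y y)) x"
proof -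
  interpret prob_space M by fact
  interpret sigma_finite_subalgebra M G
    using assms(1,2) by (rule sigma_finite_subalgebra_of_prob_space)
  \<comment> \<open>the density is an indicator: these are the laws of \<open>Y\<close> and \<open>- Y\<close> restricted to \<open>B\<close>\<close>
  have law: "distr (density M (indicator B)) borel Y = distr (density M (indicator B)) borel (\<lambda>x. - Y x)"
    if B: "B \<in> sets G" for B
  proof (rule measure_eqI)
    have [measurable]: "B \<in> sets M" using B assms(2) by (auto simp: subalgebra_def)
    fix A assume "A \<in> sets (distr (density M (indicator B)) borel Y)"
    then have A [measurable]: "A \<in> sets borel" by simp
    have meas: "emeasure (distr (density M (indicator B)) borel Z) A
        = ennreal (\<integral>x\<in>B. real_cond_exp M G (\<lambda>y. indicator A (Z y)) x \<partial>M)"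
      if [measurable]: "Z \<in> borel_measurable M" for Z :: "'a \<Rightarrow> real"
    proof -
      have int: "integrable M (\<lambda>y. indicator A (Z y) :: real)"
        by (rule integrable_const_bound[where B = 1]) (auto simp: indicator_def)
      have "emeasure (distr (density M (indicator B)) borel Z) A
          = (\<integral>\<^sup>+x. indicator B x * indicator (Z -` A \<inter> space M) x \<partial>M)"
        by (subst emeasure_distr) (auto simp: emeasure_density)
      also have "\<dots> = (\<integral>\<^sup>+x. ennreal (indicator B x * indicator A (Z x)) \<partial>M)"
        by (intro nn_integral_cong) (auto simp: indicator_def)
      also have "\<dots> = ennreal (\<integral>x. indicator B x * indicator A (Z x) \<partial>M)"
        by (intro nn_integral_eq_integral integrable_const_bound[where B = 1]) (auto simp: indicator_def)
      also have "\<dots> = ennreal (\<integral>x\<in>B. indicator A (Z x) \<partial>M)"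
        by (simp add: set_lebesgue_integral_def)
      finally show ?thesis
        using real_cond_exp_intA[OF int B] by simp
    qed
    have "(\<integral>x\<in>B. real_cond_exp M G (\<lambda>y. indicator A (Y y)) x \<partial>M)
        = (\<integral>x\<in>B. real_cond_exp M G (\<lambda>y. indicator A (- Y y)) x \<partial>M)"
      using assms(3) A unfolding cond_symmetric_rv_def set_lebesgue_integral_def
      by (intro integral_cong_AE) auto
    then show "emeasure (distr (density M (indicator B)) borel Y) A
        = emeasure (distr (density M (indicator B)) borel (\<lambda>x. - Y x)) A"
      by (simp add: meas)
  qed simp
  show ?thesis
  proof (rule AE_symmetric[OF nn_cond_exp_charact])
    fix B assume B: "B \<in> sets G"
    then have [measurable]: "B \<in> sets M" using assms(2) by (auto simp: subalgebra_def)
    have *: "(\<integral>\<^sup>+x\<in>B. h (Z x) \<partial>M) = (\<integral>\<^sup>+y. h y \<partial>distr (density M (indicator B)) borel Z)"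
      if [measurable]: "Z \<in> borel_measurable M" for Z
      by (simp add: nn_integral_distr nn_integral_density mult.commute)
    have "(\<integral>\<^sup>+x\<in>B. h (Y x) \<partial>M) = (\<integral>\<^sup>+x\<in>B. h (- Y x) \<partial>M)"
      using law[OF B] by (simp add: *)
    also have "\<dots> = (\<integral>\<^sup>+x. indicator B x * nn_cond_exp M G (\<lambda>y. h (- Y y)) x \<partial>M)"
      using B by (subst nn_cond_exp_intg) (auto simp: mult.commute)
    finally show "(\<integral>\<^sup>+x\<in>B. h (Y x) \<partial>M) = (\<integral>\<^sup>+x\<in>B. nn_cond_exp M G (\<lambda>y. h (- Y y)) x \<partial>M)"
      by (simp add: mult.commute)
  qed auto
qed

lemma cond_symmetric_abs_le:
  fixes Y :: "'a \<Rightarrow> real"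
  assumes "prob_space M" "subalgebra M G" "cond_symmetric_rv M G Y"
    and [measurable]: "Y \<in> borel_measurable M" and bd: "AE x in M. Y x \<le> d"
  shows "AE x in M. \<bar>Y x\<bar> \<le> d"
proof -
  interpret prob_space M by fact
  interpret sigma_finite_subalgebra M G
    using assms(1,2) by (rule sigma_finite_subalgebra_of_prob_space)
  have "(\<integral>\<^sup>+x. indicator {d<..} (- Y x) \<partial>M) = (\<integral>\<^sup>+x. nn_cond_exp M G (\<lambda>y. indicator {d<..} (- Y y)) x \<partial>M)"
    using nn_cond_exp_intg[of "\<lambda>_. 1" "\<lambda>y. indicator {d<..} (- Y y)"] by simp
  also have "\<dots> = (\<integral>\<^sup>+x. nn_cond_exp M G (\<lambda>y. indicator {d<..} (Y y)) x \<partial>M)"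
    using cond_symmetric_nn_cond_exp[OF assms(1-4), of "indicator {d<..}"]
    by (intro nn_integral_cong_AE) auto
  also have "\<dots> = (\<integral>\<^sup>+x. indicator {d<..} (Y x) \<partial>M)"
    using nn_cond_exp_intg[of "\<lambda>_. 1" "\<lambda>y. indicator {d<..} (Y y)"] by simp
  also have "\<dots> = 0"
    using bd by (subst nn_integral_0_iff_AE) (auto simp: indicator_def)
  finally have "AE x in M. indicator {d<..} (- Y x) = (0 :: ennreal)"
    by (subst (asm) nn_integral_0_iff_AE) auto
  with bd show ?thesis
    by eventually_elim (auto simp: indicator_def split: if_splits)
qed

text \<open>
  By symmetry \<open>Y\<close> is bounded below by \<open>- d\<close> as well, and the conditional expectation of
  \<open>exp (l * Y)\<close> is that of \<open>cosh (l * Y)\<close>. The even function \<open>cosh\<close> has the smaller constant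
  \<open>(cosh (l * d) - 1) / d\<^sup>2\<close> in its quadratic bound on \<open>[- d, d]\<close>.
\<close>
lemma nn_cond_exp_exp_symmetric:
  fixes Y :: "'a \<Rightarrow> real"
  assumes "prob_space M" "subalgebra M G" "cond_symmetric_rv M G Y"
    and [measurable]: "Y \<in> borel_measurable M" and bd: "AE x in M. Y x \<le> d"
    and "0 < d" "0 < l"
  shows "AE x in M. nn_cond_exp M G (\<lambda>y. ennreal (exp (l * Y y))) x
    \<le> 1 + ennreal ((cosh (l * d) - 1) / d\<^sup>2) * nn_cond_exp M G (\<lambda>y. ennreal ((Y y)\<^sup>2)) x"
proof -
  interpret prob_space M by fact
  interpret sigma_finite_subalgebra M G
    using assms(1,2) by (rule sigma_finite_subalgebra_of_prob_space)
  define p where "p = (cosh (l * d) - 1) / d\<^sup>2"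
  have "0 \<le> p"
    using cosh_real_ge_1[of "l * d"] by (simp add: p_def)
  let ?E = "nn_cond_exp M G"
  have "AE x in M. ?E (\<lambda>y. ennreal (exp (l * Y y)) + ennreal (exp (l * - Y y))) x
      \<le> ?E (\<lambda>y. 2 + (2 * ennreal p) * ennreal ((Y y)\<^sup>2)) x"
  proof (rule nn_cond_exp_mono)
    show "AE x in M. ennreal (exp (l * Y x)) + ennreal (exp (l * - Y x))
        \<le> 2 + (2 * ennreal p) * ennreal ((Y x)\<^sup>2)"
      using cond_symmetric_abs_le[OF assms(1-5)]
    proof eventually_elim
      case (elim x)
      have "cosh (l * Y x) \<le> 1 + p * (Y x)\<^sup>2"
        using cosh_le_quadratic[of "l * Y x" "l * d"] elim \<open>0 < l\<close> \<open>0 < d\<close>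
        by (simp add: p_def power_mult_distrib abs_mult)
      then have "exp (l * Y x) + exp (l * - Y x) \<le> 2 + (2 * p) * (Y x)\<^sup>2"
        by (simp add: cosh_field_def field_simps)
      then have "ennreal (exp (l * Y x) + exp (l * - Y x)) \<le> ennreal (2 + (2 * p) * (Y x)\<^sup>2)"
        by (rule ennreal_leI)
      then show ?case
        using \<open>0 \<le> p\<close> by (simp add: ennreal_mult)
    qed
  qed auto
  moreover have "AE x in M. ?E (\<lambda>y. ennreal (exp (l * Y y))) x + ?E (\<lambda>y. ennreal (exp (l * - Y y))) x
      = ?E (\<lambda>y. ennreal (exp (l * Y y)) + ennreal (exp (l * - Y y))) x"
    by (rule nn_cond_exp_sum) auto
  moreover have "AE x in M. ?E (\<lambda>y. 2 + (2 * ennreal p) * ennreal ((Y y)\<^sup>2)) x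
      = 2 + (2 * ennreal p) * ?E (\<lambda>y. ennreal ((Y y)\<^sup>2)) x"
    by (rule nn_cond_exp_affine) auto
  moreover have "AE x in M. ?E (\<lambda>y. ennreal (exp (l * Y y))) x = ?E (\<lambda>y. ennreal (exp (l * - Y y))) x"
    using cond_symmetric_nn_cond_exp[OF assms(1-4), of "\<lambda>t. ennreal (exp (l * t))"] by simp
  ultimately show ?thesis
  proof eventually_elim
    case (elim x)
    then have "2 * ?E (\<lambda>y. ennreal (exp (l * Y y))) x
        \<le> 2 * (1 + ennreal p * ?E (\<lambda>y. ennreal ((Y y)\<^sup>2)) x)"
      by (simp add: distrib_left mult.assoc flip: mult_2)
    then show ?case
      by (subst (asm) ennreal_mult_le_mult_iff) (auto simp: p_def)
  qed
qed

section \<open>Tail bound for the supermartingale\<close>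

context supermartingale
begin

lemma sigma_finite_subalgebra_F: "sigma_finite_subalgebra M (F n)"
  using prob_space_axioms subalgebra_F by (rule sigma_finite_subalgebra_of_prob_space)

lemma innovation_Suc_measurable: "innovation M F X (Suc k) \<in> borel_measurable (F (Suc k))"
proof -
  have "sets (F k) \<subseteq> sets (F (Suc k))" by (rule sets_F_mono) simp
  then have "real_cond_exp M (F k) (X (Suc k)) \<in> borel_measurable (F (Suc k))"
    using borel_measurable_cond_exp[of M "F k" "X (Suc k)"] by (auto simp: measurable_def space_F)
  then show ?thesis
    unfolding innovation_def using adapted[of "Suc k"] by simp
qed

lemma integrable_innovation: "integrable M (innovation M F X (Suc k))"
proof -
  interpret sigma_finite_subalgebra M "F k" by (rule sigma_finite_subalgebra_F)
  show ?thesis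
    unfolding innovation_def by (auto intro!: real_cond_exp_int integrable_X)
qed

lemma cond_exp_innovation: "AE x in M. real_cond_exp M (F k) (innovation M F X (Suc k)) x = 0"
proof -
  interpret sigma_finite_subalgebra M "F k" by (rule sigma_finite_subalgebra_F)
  let ?m = "real_cond_exp M (F k) (X (Suc k))"
  have "AE x in M. real_cond_exp M (F k) (\<lambda>x. X (Suc k) x - ?m x) x
      = ?m x - real_cond_exp M (F k) ?m x"
    by (intro real_cond_exp_diff real_cond_exp_int integrable_X)
  moreover have "AE x in M. real_cond_exp M (F k) ?m x = ?m x"
    by (intro real_cond_exp_F_meas real_cond_exp_int integrable_X) auto
  ultimately show ?thesis
    by eventually_elim (simp add: innovation_def)
qed

text \<open>
  The left-hand side minus the right-hand side is the predictable part of the Doob decomposition,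
  which is nonincreasing for a supermartingale. So only the innovations have to be controlled.
\<close>
lemma increment_le_sum_innovations:
  "AE x in M. \<forall>n. X n x - X 0 x \<le> (\<Sum>k<n. innovation M F X (Suc k) x)"
proof -
  have "AE x in M. \<forall>n. real_cond_exp M (F n) (X (Suc n)) x \<le> X n x"
    using cond_exp_le by (simp add: AE_all_countable)
  then show ?thesis
  proof eventually_elim
    case (elim x)
    show ?case
    proof
      fix n show "X n x - X 0 x \<le> (\<Sum>k<n. innovation M F X (Suc k) x)"
      proof (induction n)
        case (Suc n)
        then show ?case using elim[rule_format, of n] by (simp add: innovation_def)
      qed simp
    qed
  qed
qed

text \<open>
  If the maximum up to \<open>n\<close> reaches \<open>z\<close> while the quadratic variation at \<open>n\<close> is at most \<open>r\<close>, then at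
  an index \<open>k \<le> n\<close> where the maximum is attained it is at most \<open>r\<close> too, since it increases.
  So the event is almost surely contained in that of the exponential supermartingale bound.
\<close>
lemma tail_bound_of_cond_exp_exp:
  assumes mgf: "\<And>k. AE x in M. nn_cond_exp M (F k) (\<lambda>y. ennreal (exp (l * innovation M F X (Suc k) y))) x
      \<le> 1 + ennreal p * nn_cond_exp M (F k) (\<lambda>y. ennreal ((innovation M F X (Suc k) y)\<^sup>2)) x"
    and "0 \<le> l" "0 \<le> p" "0 \<le> r"
  shows "measure M {x \<in> space M. \<exists>n\<ge>1. Max ((\<lambda>k. X k x - X 0 x) ` {1..n}) \<ge> z
                                    \<and> quad_var M F X n x \<le> ennreal r} \<le> exp (p * r - l * z)"
proof -
  let ?\<eta> = "\<lambda>k. innovation M F X (Suc k)"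
  let ?V = "\<lambda>k. nn_cond_exp M (F k) (\<lambda>y. ennreal ((?\<eta> k y)\<^sup>2))"
  let ?E = "{x \<in> space M. \<exists>n. z \<le> (\<Sum>k<n. ?\<eta> k x) \<and> (\<Sum>k<n. ?V k x) \<le> ennreal r}"
  have V: "?V k \<in> borel_measurable (F k)" for k by simp
  note tail = exponential_supermartingale_tail[OF prob_space_axioms filtration_axioms subalgebra_F
      innovation_Suc_measurable V mgf assms(2-4)]
  have Q: "quad_var M F X n x = (\<Sum>k<n. ?V k x)" for n x
    unfolding quad_var_def by (simp add: sum.atLeast1_atMost_eq)
  have "AE x in M. x \<in> {x \<in> space M. \<exists>n\<ge>1. Max ((\<lambda>k. X k x - X 0 x) ` {1..n}) \<ge> z
                            \<and> quad_var M F X n x \<le> ennreal r} \<longrightarrow> x \<in> ?E"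
    using increment_le_sum_innovations
  proof eventually_elim
    case (elim x)
    show ?case
    proof safe
      fix n :: nat assume n: "1 \<le> n" "Max ((\<lambda>k. X k x - X 0 x) ` {1..n}) \<ge> z"
        and r: "quad_var M F X n x \<le> ennreal r"
      then obtain k where k: "k \<le> n" "z \<le> X k x - X 0 x"
        by (subst (asm) Max_ge_iff) auto
      have "(\<Sum>j<k. ?V j x) \<le> (\<Sum>j<n. ?V j x)"
        using k by (intro sum_mono2) auto
      with r have "(\<Sum>j<k. ?V j x) \<le> ennreal r" by (simp add: Q)
      moreover have "z \<le> (\<Sum>j<k. ?\<eta> j x)" using k elim by (meson order_trans)
      ultimately show "\<exists>n. z \<le> (\<Sum>k<n. ?\<eta> k x) \<and> (\<Sum>k<n. ?V k x) \<le> ennreal r" by blast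
    qed
  qed
  from finite_measure_mono_AE[OF this tail(1)] tail(2) show ?thesis by (rule order_trans)
qed

end

section \<open>Optimal exponents\<close>

text \<open>
  The chosen \<open>l\<close> minimises the left-hand side: its derivative in \<open>l\<close> vanishes when
  \<open>exp (l * d) = 1 + z * d / r\<close>.
\<close>
lemma B_fun_exponent:
  assumes "0 < z" "0 < r" "0 < d"
  defines "l \<equiv> ln (1 + z * d / r) / d"
  shows "(exp (l * d) - 1 - l * d) / d\<^sup>2 * r - l * z = - (z\<^sup>2 / (2 * r)) * B_fun (z * d / r)"
proof -
  define u where "u = z * d / r"
  have u: "0 < u" "z = u * r / d" using assms by (auto simp: u_def)
  have l: "l = ln (1 + u) / d" by (simp add: l_def u_def)
  have "exp (l * d) = 1 + u" using u \<open>0 < d\<close> by (simp add: l)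
  then show ?thesis
    unfolding u_def[symmetric] using u(1) assms(2,3)
    by (simp add: l u(2) B_fun_def field_simps power2_eq_square)
qed

text \<open>
  Again \<open>l\<close> is the minimiser; here the stationarity condition is \<open>sinh (l * d) = z * d / r\<close>.
\<close>
lemma C_fun_exponent:
  assumes "0 < z" "0 < r" "0 < d"
  defines "l \<equiv> arsinh (z * d / r) / d"
  shows "(cosh (l * d) - 1) / d\<^sup>2 * r - l * z = - (z\<^sup>2 / (2 * r)) * C_fun (z * d / r)"
proof -
  define u where "u = z * d / r"
  have u: "0 < u" "z = u * r / d" using assms by (auto simp: u_def)
  have l: "l = arsinh u / d" by (simp add: l_def u_def)
  have "cosh (l * d) = sqrt (1 + u\<^sup>2)" using \<open>0 < d\<close> by (simp add: l cosh_arsinh_real add.commute)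
  then show ?thesis
    unfolding u_def[symmetric] using u(1) assms(2,3)
    by (simp add: l u(2) C_fun_def field_simps power2_eq_square)
qed

theorem corollary3:
  fixes M :: "'a measure" and F :: "nat \<Rightarrow> 'a measure" and X :: "nat \<Rightarrow> 'a \<Rightarrow> real" and d :: real
  assumes "supermartingale M F X"
    and "d > 0"
    and "\<And>k. k \<ge> 1 \<Longrightarrow> AE x in M. innovation M F X k x \<le> d"
  shows "(\<forall>z>0. \<forall>r>0.
            measure M {x \<in> space M. \<exists>n\<ge>1. Max ((\<lambda>k. X k x - X 0 x) ` {1..n}) \<ge> z
                                        \<and> quad_var M F X n x \<le> ennreal r}
              \<le> exp (- (z\<^sup>2 / (2 * r)) * B_fun (z * d / r)))
       \<and> (conditionally_symmetric M F X \<longrightarrow>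
          (\<forall>z>0. \<forall>r>0.
            measure M {x \<in> space M. \<exists>n\<ge>1. Max ((\<lambda>k. X k x - X 0 x) ` {1..n}) \<ge> z
                                        \<and> quad_var M F X n x \<le> ennreal r}
              \<le> exp (- (z\<^sup>2 / (2 * r)) * C_fun (z * d / r))))"
proof (intro conjI allI impI)
  interpret supermartingale M F X by fact
  fix z r :: real assume z: "0 < z" and r: "0 < r"
  define l where "l = ln (1 + z * d / r) / d"
  have "0 < z * d / r" using z r \<open>d > 0\<close> by simp
  then have "0 < l" using \<open>d > 0\<close> unfolding l_def by (intro divide_pos_pos) auto
  have mgf: "AE x in M. nn_cond_exp M (F k) (\<lambda>y. ennreal (exp (l * innovation M F X (Suc k) y))) x
      \<le> 1 + ennreal ((exp (l * d) - 1 - l * d) / d\<^sup>2)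
          * nn_cond_exp M (F k) (\<lambda>y. ennreal ((innovation M F X (Suc k) y)\<^sup>2)) x" for k
    using sigma_finite_subalgebra.nn_cond_exp_exp_bounded_above[OF sigma_finite_subalgebra_F
        integrable_innovation cond_exp_innovation assms(3) \<open>d > 0\<close> \<open>0 < l\<close>] by simp
  have nonneg: "0 \<le> (exp (l * d) - 1 - l * d) / d\<^sup>2"
    using exp_ge_add_one_self[of "l * d"]
    by (intro divide_nonneg_nonneg zero_le_power2) linarith
  show "measure M {x \<in> space M. \<exists>n\<ge>1. Max ((\<lambda>k. X k x - X 0 x) ` {1..n}) \<ge> z
                                        \<and> quad_var M F X n x \<le> ennreal r}
              \<le> exp (- (z\<^sup>2 / (2 * r)) * B_fun (z * d / r))"
    unfolding B_fun_exponent[OF z r \<open>d > 0\<close>, symmetric] l_def[symmetric]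
    using \<open>0 < l\<close> r by (intro tail_bound_of_cond_exp_exp[OF mgf _ nonneg]) auto
next
  interpret supermartingale M F X by fact
  assume sym: "conditionally_symmetric M F X"
  fix z r :: real assume z: "0 < z" and r: "0 < r"
  define l where "l = arsinh (z * d / r) / d"
  have "0 < z * d / r" using z r \<open>d > 0\<close> by simp
  then have "0 < l" using \<open>d > 0\<close> unfolding l_def by (intro divide_pos_pos) auto
  have mgf: "AE x in M. nn_cond_exp M (F k) (\<lambda>y. ennreal (exp (l * innovation M F X (Suc k) y))) x
      \<le> 1 + ennreal ((cosh (l * d) - 1) / d\<^sup>2)
          * nn_cond_exp M (F k) (\<lambda>y. ennreal ((innovation M F X (Suc k) y)\<^sup>2)) x" for k
  proof (rule nn_cond_exp_exp_symmetric[OF prob_space_axioms subalgebra_F])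
    show "cond_symmetric_rv M (F k) (innovation M F X (Suc k))"
      using sym by (auto simp: conditionally_symmetric_def dest: spec[of _ "Suc k"])
    show "innovation M F X (Suc k) \<in> borel_measurable M"
      using integrable_innovation by auto
  qed (use assms(3) \<open>d > 0\<close> \<open>0 < l\<close> in auto)
  have nonneg: "0 \<le> (cosh (l * d) - 1) / d\<^sup>2"
    using cosh_real_ge_1[of "l * d"] by simp
  show "measure M {x \<in> space M. \<exists>n\<ge>1. Max ((\<lambda>k. X k x - X 0 x) ` {1..n}) \<ge> z
                                        \<and> quad_var M F X n x \<le> ennreal r}
              \<le> exp (- (z\<^sup>2 / (2 * r)) * C_fun (z * d / r))"
    unfolding C_fun_exponent[OF z r \<open>d > 0\<close>, symmetric] l_def[symmetric]
    using \<open>0 < l\<close> r by (intro tail_bound_of_cond_exp_exp[OF mgf _ nonneg]) auto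
qed

end
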